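(* Let $X, X_1, X_2, \ldots$ be i.i.d. real-valued random variables, and let $S_n = \sum_{i=1}^n X_i$ and $G_n = \frac1n\sum_{i=1}^n S_i$ for $n \ge 1$. Suppose that there are $b \in \mathbb{R}$ and $h > 0$ such that $\mathbb{P}(X \in b + h\mathbb{Z}) = 1$, where $h$ is maximal (that is, $h$ is the largest positive number for which $\mathbb{P}(X \in b' + h\mathbb{Z}) = 1$ for some $b' \in \mathbb{R}$). Suppose also that $X$ has the same distribution as $-X$ and that $X$ is in the domain of normal attraction of a symmetric $\alpha$-stable distribution with $\alpha \in (0,1)$. Then, almost surely, $\liminf_{n \to \infty} G_n = -\infty$, $\limsup_{n\to\infty} G_n = +\infty$, and $\lim_{n\to\infty} |G_n| = \infty$.
   Context: For $X$ with $X$ and $-X$ equal in distribution, "$X$ is in the domain of normal attraction of a symmetric $\alpha$-stable distribution" means that $n^{-1/\alpha} S_n$ converges in distribution, as $n \to \infty$, to a random variable with characteristic function $t \mapsto e^{-c|t|^\alpha}$ for some constant $c > 0$. *)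

theory Defs
  imports "HOL-Probability.Probability"
begin

definition affine_lattice :: "real \<Rightarrow> real \<Rightarrow> real set" where
  "affine_lattice b h = {b + h * of_int k |k :: int. True}"

text \<open>Sequences of steps are indexed from 1; the entry at index 0 is never used.\<close>

definition walk :: "(nat \<Rightarrow> 'a \<Rightarrow> real) \<Rightarrow> nat \<Rightarrow> 'a \<Rightarrow> real" where
  "walk X n \<omega> = (\<Sum>i=1..n. X i \<omega>)"

definition walk_avg :: "(nat \<Rightarrow> 'a \<Rightarrow> real) \<Rightarrow> nat \<Rightarrow> 'a \<Rightarrow> real" where
  "walk_avg X n \<omega> = (1 / real n) * (\<Sum>i=1..n. walk X i \<omega>)"

text \<open>For \<open>\<alpha> > 0\<close> the convention \<open>0 powr \<alpha> = 0\<close> gives the right value at \<open>t = 0\<close>.\<close>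

definition symmetric_stable :: "real \<Rightarrow> real measure \<Rightarrow> bool" where
  "symmetric_stable \<alpha> \<nu> \<longleftrightarrow> real_distribution \<nu> \<and>
     (\<exists>c>0. \<forall>t. char \<nu> t = complex_of_real (exp (- c * \<bar>t\<bar> powr \<alpha>)))"

text \<open>Domain of normal attraction, for the common law of an i.i.d.\ sequence \<open>X\<close> on \<open>M\<close>. The notion
  is meant for symmetric steps; symmetry is not part of the definition.\<close>

definition in_normal_attraction :: "'a measure \<Rightarrow> (nat \<Rightarrow> 'a \<Rightarrow> real) \<Rightarrow> real \<Rightarrow> bool" where
  "in_normal_attraction M X \<alpha> \<longleftrightarrow>
     (\<exists>\<nu>. symmetric_stable \<alpha> \<nu> \<and>
       weak_conv_m (\<lambda>n. distr M borel (\<lambda>\<omega>. real n powr (- 1 / \<alpha>) * walk X n \<omega>)) \<nu>)"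

end

theory Submission
  imports Defs
begin

text \<open>
  With \<open>A\<^sub>n = n G\<^sub>n = \<Sum>j\<le>n. (n + 1 - j) X\<^sub>j\<close>, the variable \<open>A\<^sub>n\<close> lives on the scale
  \<open>n powr (1 + 1/\<alpha>)\<close>, which for \<open>\<alpha> < 1\<close> exceeds \<open>n\<close> by so much that the probability of
  \<open>\<bar>A\<^sub>n\<bar> \<le> K n\<close> is summable: one expects it to be of order \<open>n powr (- 1/\<alpha>)\<close>. Borel--Cantelli then
  gives \<open>\<bar>G\<^sub>n\<bar> \<longlonglongrightarrow> \<infinity>\<close> almost surely.

  The probability is estimated without a local limit theorem. A Fejer kernel bounds the mass that a
  law puts on \<open>[-K, K]\<close> by 4 times the mean over \<open>[0, 1/K]\<close> of the modulus of its
  characteristic function (\<open>concentration_le_integral_char\<close>). The characteristic function of \<open>G\<^sub>n\<close> at \<open>t\<close> is the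
  product of the values of the one of \<open>X\<close> at \<open>(n + 1 - j) t / n\<close>, so all arguments stay in
  \<open>[0, 1/K]\<close>. Once \<open>K\<close> is large, only the behaviour of the characteristic function of \<open>X\<close> near 0
  matters, and there normal attraction bounds it by \<open>exp (- c s powr \<alpha>)\<close>
  (\<open>char_bound_of_normal_attraction\<close>). The product is then at most \<open>exp (- C n t powr \<alpha>)\<close>, whose
  integral is \<open>O(n powr - p)\<close> for any \<open>p < 1/\<alpha>\<close>, in particular for some \<open>p > 1\<close>.

  For the signs, changing finitely many steps changes \<open>G\<^sub>n\<close> by a bounded amount, so that
  \<open>limsup G\<^sub>n = \<infinity>\<close> is a tail event and has probability 0 or 1 (\<open>unbounded_above_walk_avg_0_1\<close>).
  If it had probability 0, then \<open>\<bar>G\<^sub>n\<bar> \<longlonglongrightarrow> \<infinity>\<close> would force \<open>G\<^sub>n \<le> 0\<close> eventually, and the probability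
  of \<open>G\<^sub>n > 0\<close> would tend to 0; by symmetry it tends to \<open>1/2\<close>. The statement about the limit
  inferior is the same one for the walk with steps \<open>- X\<^sub>j\<close>.
\<close>

section \<open>Concentration and characteristic functions\<close>

text \<open>The Fourier transform of the triangle function \<open>max 0 (1 - \<bar>t\<bar>)\<close> is, up to a factor 2, the
  Fejer kernel \<open>(1 - cos y) / y\<^sup>2\<close>. Its nonnegativity on the whole line, together with a positive
  lower bound near 0, is what makes it dominate a multiple of the indicator of \<open>[-1, 1]\<close>.\<close>
lemma fejer_kernel:
  fixes y :: real
  shows "(LBINT t:{0..1}. (1 - t) * cos (t * y)) \<ge> 0"
    and "\<bar>y\<bar> \<le> 1 \<Longrightarrow> (LBINT t:{0..1}. (1 - t) * cos (t * y)) \<ge> 1 / 4"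
proof -
  let ?f = "\<lambda>t. (1 - t) * cos (t * y)"
  have int: "set_integrable lborel {0..1} ?f"
    by (intro borel_integrable_atLeastAtMost' continuous_intros)
  have eq: "(LBINT t:{0..1}. ?f t) = integral {0..1} ?f"
    by (rule set_borel_integral_eq_integral(2)[OF int])
  have int': "?f integrable_on {0..1}"
    by (rule set_borel_integral_eq_integral(1)[OF int])
  have half: "((\<lambda>t. (1 - t) / 2) has_integral 1 / 4) {0..1::real}"
  proof -
    have "((\<lambda>t. (1 - t) / 2) has_integral (1 / 2 - 1\<^sup>2 / 4) - (0 / 2 - 0\<^sup>2 / 4)) {0..1::real}"
      by (rule fundamental_theorem_of_calculus)
         (auto intro!: derivative_eq_intros simp: has_real_derivative_iff_has_vector_derivative[symmetric] field_simps)
    then show ?thesis by simp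
  qed
  have quarter: "integral {0..1} ?f \<ge> 1 / 4" if y: "\<bar>y\<bar> \<le> 1"
  proof (rule has_integral_le[OF half integrable_integral[OF int']])
    fix t :: real assume t: "t \<in> {0..1}"
    have "\<bar>t * y\<bar> \<le> 1 * 1"
      unfolding abs_mult using t y by (intro mult_mono) auto
    then have "\<bar>t * y\<bar> \<le> pi / 3" using pi_gt3 by linarith
    then have "cos (pi / 3) \<le> cos \<bar>t * y\<bar>"
      by (intro cos_monotone_0_pi_le) auto
    then have "1 / 2 \<le> cos (t * y)" by (simp add: cos_60)
    then show "(1 - t) / 2 \<le> (1 - t) * cos (t * y)"
      using mult_left_mono[of "1/2" "cos (t * y)" "1 - t"] t by simp
  qed
  then show "\<bar>y\<bar> \<le> 1 \<Longrightarrow> (LBINT t:{0..1}. ?f t) \<ge> 1 / 4"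
    by (simp add: eq)
  show "(LBINT t:{0..1}. ?f t) \<ge> 0"
  proof (cases "y = 0")
    case True
    then show ?thesis using quarter eq by simp
  next
    case False
    let ?F = "\<lambda>t. (1 - t) * sin (t * y) / y - cos (t * y) / y\<^sup>2"
    have "(?f has_integral ?F 1 - ?F 0) {0..1}"
      using False
      by (intro fundamental_theorem_of_calculus)
         (auto intro!: derivative_eq_intros simp: has_real_derivative_iff_has_vector_derivative[symmetric]
            field_simps power2_eq_square)
    then have "integral {0..1} ?f = ?F 1 - ?F 0" by (rule integral_unique)
    also have "\<dots> = (1 - cos y) / y\<^sup>2"
      by (simp add: diff_divide_distrib)
    finally show ?thesis using eq by simp
  qed
qed

text \<open>A form of Esseen's concentration inequality: integrate the Fejer kernel, evaluated at
  \<open>x / a\<close>, against the law and exchange the integrals. The triangle function has compact support, so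
  only arguments up to \<open>1 / a\<close> occur; a Gaussian weight would need control of the characteristic
  function at large arguments, where that of a lattice law returns to modulus 1.\<close>
lemma (in real_distribution) concentration_le_integral_char:
  assumes a: "a > 0"
  shows "measure M {-a..a} \<le> 4 * integral {0..1} (\<lambda>t. cmod (char M (t / a)))"
proof -
  define N where "N = restrict_space lborel {0..1::real}"
  interpret N: finite_measure N
    unfolding N_def by (rule finite_measureI) (simp add: emeasure_restrict_space)
  interpret P: pair_sigma_finite M N ..
  have sN: "space N = {0..1}" by (simp add: N_def)
  have [measurable_cong]: "sets N = sets (restrict_space borel {0..1})"
    by (simp add: N_def sets_restrict_space)
  have idN[measurable]: "(\<lambda>t. t) \<in> borel_measurable N"
    by (simp add: N_def measurable_restrict_space1)
  interpret MN: finite_measure "M \<Otimes>\<^sub>M N"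
    by (rule finite_measure_pair_measure) unfold_locales
  let ?k = "\<lambda>x t. (1 - t) * cos (t * (x / a))"
  have N_int: "(\<integral>t. f t \<partial>N) = (LBINT t:{0..1}. f t)" for f :: "real \<Rightarrow> real"
    unfolding N_def set_lebesgue_integral_def by (rule integral_restrict_space) auto
  have k_bound: "\<bar>?k x t\<bar> \<le> 1" if "t \<in> {0..1}" for x t
    using that mult_mono[of "\<bar>1 - t\<bar>" 1 "\<bar>cos (t * (x / a))\<bar>" 1] by (auto simp: abs_mult)
  have int: "integrable (M \<Otimes>\<^sub>M N) (\<lambda>(x, t). ?k x t)"
  proof (rule MN.integrable_const_bound)
    show "AE z in M \<Otimes>\<^sub>M N. norm (case z of (x, t) \<Rightarrow> ?k x t) \<le> 1"
      by (rule AE_I2) (use k_bound sN in \<open>auto simp: space_pair_measure\<close>)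
    show "(\<lambda>(x, t). ?k x t) \<in> borel_measurable (M \<Otimes>\<^sub>M N)"
      by measurable
  qed
  have "measure M {-a..a} = 4 * (\<integral>x. indicator {-a..a} x * (1 / 4) \<partial>M)"
    by simp
  also have "\<dots> \<le> 4 * (\<integral>x. (\<integral>t. ?k x t \<partial>N) \<partial>M)"
  proof (intro mult_left_mono integral_mono)
    show "integrable M (\<lambda>x. indicator {-a..a} x * (1 / 4 :: real))"
      by (intro integrable_const_bound[where B = 1]) (auto simp: indicator_def)
    show "integrable M (\<lambda>x. \<integral>t. ?k x t \<partial>N)"
      using P.integrable_fst[OF int] by simp
    show "indicator {-a..a} x * (1 / 4) \<le> (\<integral>t. ?k x t \<partial>N)" for x
      using fejer_kernel[of "x / a"] a
      by (auto simp: indicator_def N_int abs_le_iff field_simps simp del: times_divide_eq_right)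
  qed auto
  also have "(\<integral>x. (\<integral>t. ?k x t \<partial>N) \<partial>M) = (\<integral>t. (\<integral>x. ?k x t \<partial>M) \<partial>N)"
    using P.Fubini_integral[OF int] by simp
  also have "\<dots> = (\<integral>t. (1 - t) * Re (char M (t / a)) \<partial>N)"
  proof (intro Bochner_Integration.integral_cong refl)
    fix t
    have "Re (char M (t / a)) = (\<integral>x. Re (iexp (t / a * x)) \<partial>M)"
      unfolding char_def by (rule integral_Re[symmetric]) (intro integrable_const_bound[where B=1], auto)
    then show "(\<integral>x. ?k x t \<partial>M) = (1 - t) * Re (char M (t / a))"
      by (simp add: Re_exp)
  qed
  also have "\<dots> \<le> (\<integral>t. cmod (char M (t / a)) \<partial>N)"
  proof (rule integral_mono)
    have [measurable]: "(\<lambda>t. char M (t / a)) \<in> borel_measurable N"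
      by measurable
    show "integrable N (\<lambda>t. (1 - t) * Re (char M (t / a)))"
    proof (rule N.integrable_const_bound[where B=1])
      show "AE t in N. norm ((1 - t) * Re (char M (t / a))) \<le> 1"
      proof (rule AE_I2)
        fix t assume "t \<in> space N"
        then show "norm ((1 - t) * Re (char M (t / a))) \<le> 1"
          using mult_mono[of "\<bar>1 - t\<bar>" 1 "\<bar>Re (char M (t / a))\<bar>" 1] cmod_char_le_1[of "t/a"]
            abs_Re_le_cmod[of "char M (t / a)"]
          by (auto simp: sN abs_mult)
      qed
    qed measurable
    show "integrable N (\<lambda>t. cmod (char M (t / a)))"
      by (rule N.integrable_const_bound[where B=1]) (auto simp: cmod_char_le_1)
    fix t assume "t \<in> space N"
    then have t: "0 \<le> t" "t \<le> 1" by (auto simp: sN)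
    have "(1 - t) * Re (char M (t / a)) \<le> (1 - t) * cmod (char M (t / a))"
      using t by (intro mult_left_mono complex_Re_le_cmod) auto
    also have "\<dots> \<le> 1 * cmod (char M (t / a))"
      using t by (intro mult_right_mono) auto
    finally show "(1 - t) * Re (char M (t / a)) \<le> cmod (char M (t / a))" by simp
  qed
  also have "\<dots> = integral {0..1} (\<lambda>t. cmod (char M (t / a)))"
  proof -
    have "continuous_on {0..1} (\<lambda>t. cmod (char M (t / a)))"
      using a by (intro continuous_at_imp_continuous_on ballI continuous_intros
          continuous_within_compose3[OF isCont_char]) auto
    then show ?thesis
      unfolding N_int by (intro set_borel_integral_eq_integral(2) borel_integrable_atLeastAtMost')
  qed
  finally show ?thesis by simp
qed

section \<open>The characteristic function of a normally attracted law near 0\<close>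

text \<open>Skorohod's coupling turns weak convergence into pointwise convergence, so dominated convergence
  also allows the argument to vary with the index. This takes the place of uniform convergence on
  compact sets.\<close>
lemma char_tendsto_along:
  assumes "\<And>n. real_distribution (\<mu> n)" "real_distribution \<nu>" "weak_conv_m \<mu> \<nu>"
    and r: "filterlim r at_top sequentially" and t: "t \<longlonglongrightarrow> t0"
  shows "(\<lambda>m. char (\<mu> (r m)) (t m)) \<longlonglongrightarrow> char \<nu> t0"
proof -
  obtain Omega :: "real measure" and Y_seq :: "nat \<Rightarrow> real \<Rightarrow> real" and Y where
    ps: "prob_space Omega" and
    [measurable]: "\<And>n. Y_seq n \<in> borel_measurable Omega" and
    distr_Y_seq: "\<And>n. distr Omega borel (Y_seq n) = \<mu> n" and
    [measurable]: "Y \<in> borel_measurable Omega" and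
    distr_Y: "distr Omega borel Y = \<nu>" and
    YnY: "\<And>x :: real. x \<in> space Omega \<Longrightarrow> (\<lambda>n. Y_seq n x) \<longlonglongrightarrow> Y x"
    using Skorohod[OF assms(1-3)] by force
  interpret prob_space Omega by fact
  have "char (\<mu> n) s = (CLINT x|Omega. iexp (s * Y_seq n x))" for n s
    unfolding char_def distr_Y_seq[symmetric] by (subst integral_distr) auto
  moreover have "char \<nu> t0 = (CLINT x|Omega. iexp (t0 * Y x))"
    unfolding char_def distr_Y[symmetric] by (subst integral_distr) auto
  moreover have "(\<lambda>m. CLINT x|Omega. iexp (t m * Y_seq (r m) x)) \<longlonglongrightarrow> (CLINT x|Omega. iexp (t0 * Y x))"
  proof (rule integral_dominated_convergence[where w = "\<lambda>_. 1"])
    show "AE x in Omega. (\<lambda>m. iexp (t m * Y_seq (r m) x)) \<longlonglongrightarrow> iexp (t0 * Y x)"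
      by (intro AE_I2 tendsto_intros t filterlim_compose[OF YnY r])
  qed auto
  ultimately show ?thesis by simp
qed

lemma (in prob_space) char_distr_cmult:
  assumes [measurable]: "random_variable borel Y"
  shows "char (distr M borel (\<lambda>\<omega>. a * Y \<omega>)) t = char (distr M borel Y) (a * t)"
  unfolding char_def by (simp add: integral_distr mult_ac)

text \<open>The attraction only speaks of the arguments \<open>t n powr (- 1/\<alpha>)\<close>. An arbitrary small \<open>s\<close> is matched
  with \<open>n = \<lceil>s powr - \<alpha>\<rceil>\<close>, for which \<open>t = s n powr (1/\<alpha>)\<close> is close to 1; hence the \<open>n\<close>-th power of the
  characteristic function at \<open>s\<close> is close to \<open>exp (- c)\<close>, whereas \<open>n\<close> is close to \<open>s powr - \<alpha>\<close>.
  Replacing \<open>c\<close> by \<open>c / 2\<close> absorbs the errors.\<close>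
lemma (in prob_space) char_bound_of_normal_attraction:
  assumes indep: "indep_vars (\<lambda>_. borel) Xs {1..}"
    and law: "\<And>i. i \<ge> 1 \<Longrightarrow> distr M borel (Xs i) = \<mu>"
    and \<alpha>: "\<alpha> > 0"
    and attraction: "in_normal_attraction M Xs \<alpha>"
  shows "\<exists>c>0. \<exists>d>0. \<forall>s. 0 < s \<longrightarrow> s \<le> d \<longrightarrow> cmod (char \<mu> s) \<le> exp (- c * s powr \<alpha>)"
proof -
  have [measurable]: "Xs i \<in> borel_measurable M" if "i \<in> {1..}" for i
    using indep that by (auto simp: indep_vars_def)
  have walk_meas [measurable]: "walk Xs n \<in> borel_measurable M" for n
    unfolding walk_def by (intro borel_measurable_sum) auto
  define \<mu>s where "\<mu>s n = distr M borel (\<lambda>\<omega>. real n powr (- 1 / \<alpha>) * walk Xs n \<omega>)" for n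
  obtain \<nu> c where \<nu>: "real_distribution \<nu>" and "c > 0"
    and char_\<nu>: "\<And>t. char \<nu> t = complex_of_real (exp (- c * \<bar>t\<bar> powr \<alpha>))"
    and conv: "weak_conv_m \<mu>s \<nu>"
    using attraction unfolding in_normal_attraction_def symmetric_stable_def \<mu>s_def by blast
  have rd: "real_distribution (\<mu>s n)" for n
    unfolding \<mu>s_def by (intro real_distribution_distr) measurable
  have char_\<mu>s: "char (\<mu>s n) t = char \<mu> (real n powr (- 1 / \<alpha>) * t) ^ n" for n t
  proof -
    have "char (distr M borel (walk Xs n)) s = char \<mu> s ^ n" for s
      using char_distr_sum[OF indep_vars_subset[OF indep], of "{1..n}" s] law
      by (simp add: walk_def[abs_def])
    then show ?thesis
      unfolding \<mu>s_def by (subst char_distr_cmult) auto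
  qed
  have "\<exists>d>0. \<forall>s. 0 < s \<longrightarrow> s \<le> d \<longrightarrow> cmod (char \<mu> s) \<le> exp (- (c / 2) * s powr \<alpha>)"
  proof (rule ccontr)
    assume neg: "\<not> ?thesis"
    have "\<exists>s. 0 < s \<and> s \<le> 1 / real (Suc m) \<and> exp (- (c / 2) * s powr \<alpha>) < cmod (char \<mu> s)" for m
    proof -
      have "1 / real (Suc m) > 0" by simp
      with neg show ?thesis by (meson not_le)
    qed
    then obtain s where s_pos: "\<And>m. 0 < s m" and s_le: "\<And>m. s m \<le> 1 / real (Suc m)"
      and big: "\<And>m. exp (- (c / 2) * s m powr \<alpha>) < cmod (char \<mu> (s m))"
      by metis
    have s0: "s \<longlonglongrightarrow> 0"
      using s_pos s_le
      by (intro tendsto_sandwich[OF _ _ tendsto_const LIMSEQ_Suc[OF lim_1_over_n]])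
         (auto intro!: always_eventually less_imp_le)
    define r where "r m = nat \<lceil>s m powr - \<alpha>\<rceil>" for m
    define q where "q m = real (r m) * s m powr \<alpha>" for m
    have r_real: "real (r m) = of_int \<lceil>s m powr - \<alpha>\<rceil>" for m
    proof -
      have "0 \<le> s m powr - \<alpha>" by simp
      then have "0 \<le> \<lceil>s m powr - \<alpha>\<rceil>" by linarith
      then show ?thesis unfolding r_def by (rule of_nat_nat)
    qed
    have r_pos: "real (r m) > 0" for m
    proof -
      have "0 < s m powr - \<alpha>" using s_pos[of m] by simp
      then show ?thesis unfolding r_real using le_of_int_ceiling[of "s m powr - \<alpha>"] by linarith
    qed
    have inv: "s m powr - \<alpha> * s m powr \<alpha> = 1" for m
      using s_pos[of m] by (simp add: powr_add[symmetric])
    have q_ge: "1 \<le> q m" for m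
      unfolding q_def r_real inv[of m, symmetric] by (intro mult_right_mono) auto
    have q_le: "q m \<le> 1 + s m powr \<alpha>" for m
    proof -
      have "q m \<le> (s m powr - \<alpha> + 1) * s m powr \<alpha>"
        unfolding q_def r_real by (intro mult_right_mono) (linarith | simp)+
      also have "\<dots> = 1 + s m powr \<alpha>" by (simp add: distrib_right inv)
      finally show ?thesis .
    qed
    have s\<alpha>: "(\<lambda>m. s m powr \<alpha>) \<longlonglongrightarrow> 0"
      by (rule tendsto_zero_powrI[OF s0 tendsto_const]) (use \<alpha> s_pos in \<open>auto intro!: always_eventually less_imp_le\<close>)
    have q1: "q \<longlonglongrightarrow> 1"
      by (rule tendsto_sandwich[of "\<lambda>_. 1" q _ "\<lambda>m. 1 + s m powr \<alpha>"])
         (use q_ge q_le tendsto_add[OF tendsto_const[of 1] s\<alpha>] in \<open>auto intro!: always_eventually\<close>)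
    have r_top: "filterlim r at_top sequentially"
    proof -
      have "filterlim (\<lambda>m. inverse (s m powr \<alpha>)) at_top sequentially"
        by (rule filterlim_inverse_at_top[OF s\<alpha>]) (use s_pos in \<open>auto intro!: always_eventually simp: less_le\<close>)
      then have "filterlim (\<lambda>m. real (r m)) at_top sequentially"
      proof (rule filterlim_at_top_mono)
        show "\<forall>\<^sub>F m in sequentially. inverse (s m powr \<alpha>) \<le> real (r m)"
          by (auto intro!: always_eventually simp: r_real powr_minus[symmetric])
      qed
      then show ?thesis by (simp add: filterlim_sequentially_iff_filterlim_real)
    qed
    \<comment> \<open>\<open>q m powr (1 / \<alpha>)\<close> is \<open>s m\<close> multiplied by the norming sequence at \<open>r m\<close>\<close>
    have "(\<lambda>m. char (\<mu>s (r m)) (q m powr (1 / \<alpha>))) \<longlonglongrightarrow> char \<nu> (1 powr (1 / \<alpha>))"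
      by (intro char_tendsto_along[OF rd \<nu> conv r_top] tendsto_powr q1 tendsto_const) auto
    moreover have "char (\<mu>s (r m)) (q m powr (1 / \<alpha>)) = char \<mu> (s m) ^ r m" for m
      using r_pos[of m] s_pos[of m] \<alpha>
      by (simp add: char_\<mu>s q_def powr_mult powr_powr powr_add[symmetric] mult.assoc[symmetric])
    ultimately have "(\<lambda>m. cmod (char \<mu> (s m) ^ r m)) \<longlonglongrightarrow> cmod (char \<nu> 1)"
      by (auto intro: tendsto_norm)
    then have lim1: "(\<lambda>m. cmod (char \<mu> (s m)) ^ r m) \<longlonglongrightarrow> exp (- c)"
      by (simp add: char_\<nu> norm_power)
    have lim2: "(\<lambda>m. exp (- (c / 2) * q m)) \<longlonglongrightarrow> exp (- (c / 2) * 1)"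
      by (intro tendsto_intros q1)
    have "exp (- (c / 2) * q m) \<le> cmod (char \<mu> (s m)) ^ r m" for m
    proof -
      have "exp (- (c / 2) * q m) = exp (- (c / 2) * s m powr \<alpha>) ^ r m"
        unfolding exp_of_nat_mult[symmetric] q_def by (simp add: mult_ac)
      also have "\<dots> \<le> cmod (char \<mu> (s m)) ^ r m"
        using big[of m] by (intro power_mono) auto
      finally show ?thesis .
    qed
    then have "exp (- (c / 2) * 1) \<le> exp (- c)"
      by (intro LIMSEQ_le[OF lim2 lim1]) auto
    with \<open>c > 0\<close> show False by simp
  qed
  with \<open>c > 0\<close> show ?thesis
    by (intro exI[of _ "c / 2"]) auto
qed

section \<open>Auxiliary estimates\<close>

lemma sum_walk_eq:
  "(\<Sum>i=1..n. walk X i \<omega>) = (\<Sum>j=1..n. (real n + 1 - real j) * X j \<omega>)"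
proof (induction n)
  case (Suc n)
  have "(\<Sum>j=1..Suc n. (real (Suc n) + 1 - real j) * X j \<omega>)
      = (\<Sum>j=1..n. (real (Suc n) + 1 - real j) * X j \<omega>) + X (Suc n) \<omega>"
    by simp
  also have "(\<Sum>j=1..n. (real (Suc n) + 1 - real j) * X j \<omega>)
      = (\<Sum>j=1..n. (real n + 1 - real j) * X j \<omega>) + (\<Sum>j=1..n. X j \<omega>)"
    by (simp add: sum.distrib[symmetric] algebra_simps)
  finally show ?case using Suc by (simp add: walk_def)
qed simp

lemma exp_minus_le_powr:
  fixes u p :: real
  assumes "u > 0" "p > 0"
  shows "exp (- u) \<le> (p / u) powr p"
proof -
  have "(u / p) powr p \<le> exp (u / p) powr p"
    using assms order_trans[OF _ exp_ge_add_one_self, of "u / p" "u / p"] by (intro powr_mono2) auto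
  also have "\<dots> = exp u" using assms by (simp add: exp_powr_real)
  finally have "exp (- u) \<le> inverse ((u / p) powr p)"
    using assms by (simp add: exp_minus)
  also have "\<dots> = (p / u) powr p"
    using assms by (simp add: powr_divide)
  finally show ?thesis .
qed

text \<open>The integral of the exponential has order \<open>C powr (- 1/\<alpha>)\<close> for large \<open>C\<close>; trading the exponential for a power with
  \<open>p < 1/\<alpha>\<close>, which keeps the singularity at 0 integrable, avoids the Gamma integral.\<close>
lemma integral_exp_powr_le:
  fixes \<alpha> p C :: real
  assumes \<alpha>: "\<alpha> > 0" and p: "p > 0" "\<alpha> * p < 1" and C: "C > 0"
    and f: "f integrable_on {0..1}" and le: "\<And>t. 0 < t \<Longrightarrow> t \<le> 1 \<Longrightarrow> f t \<le> exp (- C * t powr \<alpha>)"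
  shows "integral {0..1} f \<le> (p / C) powr p / (1 - \<alpha> * p)"
proof -
  let ?g = "\<lambda>t. (p / C) powr p * t powr (- (\<alpha> * p))"
  have g: "(?g has_integral (p / C) powr p * (1 powr (- (\<alpha> * p) + 1) / (- (\<alpha> * p) + 1))) {0..1}"
    using p by (intro has_integral_mult_right has_integral_powr_from_0) auto
  have "integral {0..1} f \<le> (p / C) powr p * (1 powr (- (\<alpha> * p) + 1) / (- (\<alpha> * p) + 1))"
  proof (rule has_integral_le)
    \<comment> \<open>at 0 the majorant has the default value 0, so \<open>f\<close> has to be changed there\<close>
    let ?f = "\<lambda>t. if t = 0 then 0 else f t"
    show "(?f has_integral integral {0..1} f) {0..1}"
      by (rule has_integral_spike_finite[OF _ _ integrable_integral[OF f], of "{0}"]) auto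
    show "?f t \<le> ?g t" if "t \<in> {0..1}" for t
    proof (cases "t = 0")
      case False
      then have t: "0 < t" "t \<le> 1" using that by auto
      have "f t \<le> exp (- (C * t powr \<alpha>))" using le[OF t] by simp
      also have "\<dots> \<le> (p / (C * t powr \<alpha>)) powr p"
        using C t p by (intro exp_minus_le_powr) auto
      also have "\<dots> = ?g t"
        using C t p by (simp add: powr_divide powr_mult powr_powr powr_minus field_simps)
      finally show ?thesis using False by simp
    qed simp
  qed (rule g)
  then show ?thesis by (simp add: field_simps)
qed

section \<open>A zero-one law for the averages\<close>

text \<open>For real sequences this is \<open>limsup g = \<infinity>\<close>, written with countable quantifiers so that
  measurability with respect to any sub-\<open>\<sigma>\<close>-algebra is immediate.\<close>
definition unbounded_above :: "(nat \<Rightarrow> real) \<Rightarrow> bool" where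
  "unbounded_above g \<longleftrightarrow> (\<forall>K::nat. \<forall>N. \<exists>n\<ge>N. real K < g n)"

lemma unbounded_above_transfer:
  assumes "unbounded_above f" and bound: "\<And>n. \<bar>f n - g n\<bar> \<le> B"
  shows "unbounded_above g"
  unfolding unbounded_above_def
proof (intro allI)
  fix K N :: nat
  obtain L :: nat where L: "real K + B < real L" using reals_Archimedean2 by blast
  obtain n where n: "n \<ge> N" "real L < f n"
    using assms(1) unfolding unbounded_above_def by blast
  have "real K < g n" using L n(2) bound[of n] by linarith
  with n(1) show "\<exists>n\<ge>N. real K < g n" by blast
qed

lemma limsup_eq_infty_of_unbounded_above:
  assumes "unbounded_above g"
  shows "limsup (\<lambda>n. ereal (g n)) = \<infinity>"
proof (rule ereal_top)
  fix B :: real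
  obtain K :: nat where K: "B < real K" using reals_Archimedean2 by blast
  have "ereal (real K) \<le> limsup (\<lambda>n. ereal (g n))"
    unfolding limsup_INF_SUP
  proof (rule INF_greatest)
    fix N :: nat
    obtain n where n: "n \<ge> N" "real K < g n"
      using assms unfolding unbounded_above_def by blast
    then show "ereal (real K) \<le> (SUP m\<in>{N..}. ereal (g m))"
      by (intro SUP_upper2[of n]) auto
  qed
  then show "ereal B \<le> limsup (\<lambda>n. ereal (g n))"
    using K by (meson ereal_less_eq(3) less_imp_le order_trans)
qed

lemma (in prob_space) indep_vars_Suc:
  assumes indep: "indep_vars (\<lambda>_. N) Xs {1..}"
  shows "indep_vars (\<lambda>_. N) (\<lambda>i. Xs (Suc i)) UNIV"
  unfolding indep_vars_def2
proof (intro conjI ballI)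
  show "random_variable N (Xs (Suc i))" for i
    using indep by (auto simp: indep_vars_def2)
  let ?F = "\<lambda>i. {Xs i -` B \<inter> space M | B. B \<in> sets N}"
  have F: "indep_sets ?F {1..}"
    using indep by (simp add: indep_vars_def2)
  show "indep_sets (\<lambda>i. ?F (Suc i)) UNIV"
  proof (rule indep_setsI)
    show "?F (Suc i) \<subseteq> events" for i
      using F by (auto simp: indep_sets_def)
    fix A :: "nat \<Rightarrow> 'a set" and J
    assume J: "J \<noteq> {}" "J \<subseteq> UNIV" "finite J" and A: "\<forall>j\<in>J. A j \<in> ?F (Suc j)"
    have "prob (\<Inter>j\<in>Suc ` J. A (j - 1)) = (\<Prod>j\<in>Suc ` J. prob (A (j - 1)))"
      by (rule indep_setsD[OF F]) (use J A in auto)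
    then show "prob (\<Inter>j\<in>J. A j) = (\<Prod>j\<in>J. prob (A j))"
      by (simp add: prod.reindex)
  qed
qed

text \<open>The first \<open>m\<close> steps enter the average with weights in \<open>[0, 1]\<close>, so dropping them changes it by at
  most \<open>\<Sum>j\<le>m. \<bar>X\<^sub>j\<bar>\<close>, a bound that does not depend on \<open>n\<close>. Thus the event is measurable with respect
  to the steps after \<open>m\<close> for every \<open>m\<close>.\<close>
lemma (in prob_space) unbounded_above_walk_avg_0_1:
  assumes indep: "indep_vars (\<lambda>_. borel) Xs {1..}"
  shows "(AE \<omega> in M. unbounded_above (\<lambda>n. walk_avg Xs n \<omega>)) \<or>
         (AE \<omega> in M. \<not> unbounded_above (\<lambda>n. walk_avg Xs n \<omega>))"
proof -
  define A where "A i = {Xs (Suc i) -` B \<inter> space M | B. B \<in> sets borel}" for i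
  let ?U = "{\<omega> \<in> space M. unbounded_above (\<lambda>n. walk_avg Xs n \<omega>)}"
  have X_meas: "Xs i \<in> borel_measurable M" if "i \<ge> 1" for i
    using indep that by (auto simp: indep_vars_def)
  have A_sa: "sigma_algebra (space M) (A i)" for i
    using sets.sigma_algebra_axioms[of "vimage_algebra (space M) (Xs (Suc i)) borel"]
    by (simp add: A_def sets_vimage_algebra2)
  have "indep_vars (\<lambda>_. borel) (\<lambda>i. Xs (Suc i)) UNIV"
    using indep by (rule indep_vars_Suc)
  then have A_indep: "indep_sets A UNIV"
    unfolding indep_vars_def2 A_def by blast
  have U_tail: "?U \<in> tail_events A"
    unfolding tail_events_def
  proof
    fix m
    define N where "N = sigma (space M) (\<Union> (A ` {m..}))"
    have A_sub: "\<Union> (A ` {m..}) \<subseteq> Pow (space M)" by (auto simp: A_def)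
    have spN: "space N = space M" and setsN: "sets N = sigma_sets (space M) (\<Union> (A ` {m..}))"
      unfolding N_def using A_sub by (auto simp: space_measure_of sets_measure_of)
    have XN: "Xs j \<in> borel_measurable N" if "j \<in> {m+1..n}" for j n
    proof (rule measurableI)
      fix B :: "real set" assume "B \<in> sets borel"
      moreover obtain i where "j = Suc i" "i \<ge> m" using \<open>j \<in> {m+1..n}\<close> by (cases j) auto
      ultimately have "Xs j -` B \<inter> space M \<in> \<Union> (A ` {m..})" by (auto simp: A_def)
      then show "Xs j -` B \<inter> space N \<in> sets N" unfolding setsN spN by (rule sigma_sets.Basic)
    qed auto
    \<comment> \<open>the average without the contribution of the first \<open>m\<close> steps\<close>
    define G where "G n \<omega> = (1 / real n) * (\<Sum>j=m+1..n. (real n + 1 - real j) * Xs j \<omega>)" for n \<omega>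
    have [measurable]: "G n \<in> borel_measurable N" for n
      unfolding G_def by (intro borel_measurable_times borel_measurable_const borel_measurable_sum XN)
    have diff: "\<bar>walk_avg Xs n \<omega> - G n \<omega>\<bar> \<le> (\<Sum>j=1..m. \<bar>Xs j \<omega>\<bar>)" for n \<omega>
    proof (cases "n = 0")
      case False
      let ?T = "\<lambda>j. (real n + 1 - real j) / real n * Xs j \<omega>"
      have "walk_avg Xs n \<omega> = (\<Sum>j=1..n. ?T j)"
        unfolding walk_avg_def sum_walk_eq by (simp add: sum_divide_distrib)
      moreover have "G n \<omega> = (\<Sum>j=m+1..n. ?T j)"
        unfolding G_def by (simp add: sum_divide_distrib)
      moreover have "(\<Sum>j=1..n. ?T j) - (\<Sum>j=m+1..n. ?T j) = (\<Sum>j\<in>{1..n} - {m+1..n}. ?T j)"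
        by (subst sum_diff) auto
      ultimately have "walk_avg Xs n \<omega> - G n \<omega> = (\<Sum>j\<in>{1..n} - {m+1..n}. ?T j)"
        by (simp only:)
      then have "\<bar>walk_avg Xs n \<omega> - G n \<omega>\<bar> \<le> (\<Sum>j\<in>{1..n} - {m+1..n}. \<bar>?T j\<bar>)"
        by (simp only: sum_abs)
      also have "\<dots> \<le> (\<Sum>j\<in>{1..n} - {m+1..n}. \<bar>Xs j \<omega>\<bar>)"
      proof (rule sum_mono)
        fix j assume "j \<in> {1..n} - {m+1..n}"
        then have "\<bar>(real n + 1 - real j) / real n\<bar> \<le> 1" by auto
        then show "\<bar>?T j\<bar> \<le> \<bar>Xs j \<omega>\<bar>"
          unfolding abs_mult by (rule mult_left_le_one_le[rotated 2]) auto
      qed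
      also have "\<dots> \<le> (\<Sum>j=1..m. \<bar>Xs j \<omega>\<bar>)"
        by (rule sum_mono2) auto
      finally show ?thesis .
    qed (simp add: walk_avg_def G_def sum_nonneg)
    have "unbounded_above (\<lambda>n. walk_avg Xs n \<omega>) \<longleftrightarrow> unbounded_above (\<lambda>n. G n \<omega>)" for \<omega>
      using unbounded_above_transfer[OF _ diff[of _ \<omega>]]
        unbounded_above_transfer[of "\<lambda>n. G n \<omega>" "\<lambda>n. walk_avg Xs n \<omega>" "\<Sum>j=1..m. \<bar>Xs j \<omega>\<bar>"] diff[of _ \<omega>]
      by (auto simp: abs_minus_commute)
    then have "?U = {\<omega> \<in> space N. unbounded_above (\<lambda>n. G n \<omega>)}"
      by (simp add: spN)
    also have "\<dots> \<in> sets N"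
      unfolding unbounded_above_def by measurable
    finally show "?U \<in> sigma_sets (space M) (\<Union> (A ` {m..}))"
      by (simp add: setsN)
  qed
  have U: "?U \<in> events"
    using tail_events_sets[of A] A_indep U_tail by (auto simp: indep_sets_def)
  from kolmogorov_0_1_law[OF A_sa A_indep U_tail] show ?thesis
  proof
    assume "prob ?U = 0"
    then show ?thesis using U by (auto simp: prob_eq_0 elim: AE_mp intro!: AE_I2)
  next
    assume "prob ?U = 1"
    then show ?thesis using U by (auto simp: prob_eq_1)
  qed
qed

section \<open>The averages of a symmetric walk\<close>

text \<open>The hypotheses on the step law are invariant under reflection, so each result also
  applies to the reflected walk.\<close>
locale symmetric_walk = prob_space M for M :: "'a measure" +
  fixes Xs :: "nat \<Rightarrow> 'a \<Rightarrow> real" and \<mu> :: "real measure" and \<alpha> c d :: real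
  assumes indep: "indep_vars (\<lambda>_. borel) Xs {1..}"
    and law: "\<And>i. i \<ge> 1 \<Longrightarrow> distr M borel (Xs i) = \<mu>"
    and sym: "distr \<mu> borel uminus = \<mu>"
    and \<alpha>: "0 < \<alpha>" "\<alpha> < 1" and c: "c > 0" and d: "d > 0"
    and char_le: "\<And>s. 0 < s \<Longrightarrow> s \<le> d \<Longrightarrow> cmod (char \<mu> s) \<le> exp (- c * s powr \<alpha>)"
begin

lemma X_measurable: "i \<ge> 1 \<Longrightarrow> Xs i \<in> borel_measurable M"
  using indep by (auto simp: indep_vars_def)

lemma walk_avg_measurable [measurable]: "walk_avg Xs n \<in> borel_measurable M"
  unfolding walk_avg_def sum_walk_eq
  by (intro borel_measurable_times borel_measurable_const borel_measurable_sum X_measurable) auto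

lemma symmetric_walk_uminus: "symmetric_walk M (\<lambda>i \<omega>. - Xs i \<omega>) \<mu> \<alpha> c d"
proof unfold_locales
  show "indep_vars (\<lambda>_. borel) (\<lambda>i \<omega>. - Xs i \<omega>) {1..}"
    by (rule indep_vars_compose2[OF indep]) auto
  show "distr M borel (\<lambda>\<omega>. - Xs i \<omega>) = \<mu>" if "i \<ge> 1" for i
  proof -
    have "distr M borel (\<lambda>\<omega>. - Xs i \<omega>) = distr (distr M borel (Xs i)) borel uminus"
      by (subst distr_distr) (use X_measurable[OF that] in \<open>auto simp: comp_def\<close>)
    then show ?thesis using law[OF that] sym by simp
  qed
qed (use sym \<alpha> c d char_le in auto)

lemma walk_avg_uminus: "walk_avg (\<lambda>i \<omega>. - Xs i \<omega>) n \<omega> = - walk_avg Xs n \<omega>"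
  unfolding walk_avg_def walk_def by (simp add: sum_negf)

lemma real_distribution_walk_avg: "real_distribution (distr M borel (walk_avg Xs n))"
  by (intro real_distribution_distr) measurable

lemma char_walk_avg:
  "char (distr M borel (walk_avg Xs n)) t = (\<Prod>j=1..n. char \<mu> ((real n + 1 - real j) / real n * t))"
proof -
  let ?a = "\<lambda>j. (real n + 1 - real j) / real n"
  have "walk_avg Xs n = (\<lambda>\<omega>. \<Sum>j=1..n. ?a j * Xs j \<omega>)"
    unfolding walk_avg_def sum_walk_eq by (simp add: sum_divide_distrib fun_eq_iff)
  moreover have "indep_vars (\<lambda>_. borel) (\<lambda>j \<omega>. ?a j * Xs j \<omega>) {1..n}"
    by (rule indep_vars_compose2[OF indep_vars_subset[OF indep]]) auto
  ultimately have "char (distr M borel (walk_avg Xs n)) t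
      = (\<Prod>j=1..n. char (distr M borel (\<lambda>\<omega>. ?a j * Xs j \<omega>)) t)"
    by (simp add: char_distr_sum)
  also have "\<dots> = (\<Prod>j=1..n. char \<mu> (?a j * t))"
    by (intro prod.cong refl) (simp add: char_distr_cmult X_measurable law del: times_divide_eq_left)
  finally show ?thesis .
qed

text \<open>The characteristic function of an average depends on the steps only through their common law,
  which the reflected walk shares.\<close>
lemma distr_walk_avg_uminus:
  "distr M borel (walk_avg (\<lambda>i \<omega>. - Xs i \<omega>) n) = distr M borel (walk_avg Xs n)"
proof -
  interpret neg: symmetric_walk M "\<lambda>i \<omega>. - Xs i \<omega>" \<mu> \<alpha> c d
    by (rule symmetric_walk_uminus)
  show ?thesis
    by (intro Levy_uniqueness neg.real_distribution_walk_avg real_distribution_walk_avg ext)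
      (simp add: char_walk_avg neg.char_walk_avg)
qed

text \<open>As \<open>\<alpha> < 1\<close>, each weight \<open>a \<in> [0, 1]\<close> satisfies \<open>a powr \<alpha> \<ge> a\<close>; so the exponents, which are
  \<open>a powr \<alpha>\<close> up to a common factor, add up to at least the sum \<open>(n + 1) / 2\<close> of the weights.\<close>
lemma cmod_char_walk_avg_le:
  assumes K: "1 / K \<le> d" "K > 0" and n: "n \<ge> 1" and t: "0 < t" "t \<le> 1"
  shows "cmod (char (distr M borel (walk_avg Xs n)) (t / K))
    \<le> exp (- (c / 2 * (1 / K) powr \<alpha> * real n) * t powr \<alpha>)"
proof -
  let ?a = "\<lambda>j. (real n + 1 - real j) / real n"
  have "cmod (char (distr M borel (walk_avg Xs n)) (t / K)) = (\<Prod>j=1..n. cmod (char \<mu> (?a j * (t / K))))"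
    by (simp add: char_walk_avg prod_norm)
  also have "\<dots> \<le> (\<Prod>j=1..n. exp (- c * (t / K) powr \<alpha> * ?a j))"
  proof (intro prod_mono conjI norm_ge_zero)
    fix j assume j: "j \<in> {1..n}"
    then have a: "0 < ?a j" "?a j \<le> 1" using n by auto
    have "?a j * (t / K) \<le> 1 * (1 / K)"
      using a t K by (intro mult_mono divide_right_mono) auto
    then have "cmod (char \<mu> (?a j * (t / K))) \<le> exp (- c * (?a j * (t / K)) powr \<alpha>)"
      using a t K order_trans by (intro char_le mult_pos_pos[OF a(1)]) auto
    also have "\<dots> \<le> exp (- c * (t / K) powr \<alpha> * ?a j)"
    proof -
      have "?a j = ?a j powr 1"
        by (rule powr_one[symmetric]) (use a in linarith)
      also have "\<dots> \<le> ?a j powr \<alpha>"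
        using a \<alpha> by (intro powr_mono') auto
      finally have "?a j \<le> ?a j powr \<alpha>" .
      then have "?a j * (t / K) powr \<alpha> \<le> ?a j powr \<alpha> * (t / K) powr \<alpha>"
        by (intro mult_right_mono) auto
      also have "\<dots> = (?a j * (t / K)) powr \<alpha>"
        using a t K by (intro powr_mult[symmetric])
      finally have "c * (?a j * (t / K) powr \<alpha>) \<le> c * (?a j * (t / K)) powr \<alpha>"
        using c by (intro mult_left_mono) auto
      then show ?thesis by (simp add: mult_ac)
    qed
    finally show "cmod (char \<mu> (?a j * (t / K))) \<le> exp (- c * (t / K) powr \<alpha> * ?a j)" .
  qed
  also have "\<dots> = exp (\<Sum>j=1..n. - c * (t / K) powr \<alpha> * ?a j)"
    by (simp add: exp_sum)
  also have "\<dots> = exp (- c * (t / K) powr \<alpha> * (\<Sum>j=1..n. ?a j))"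
    by (simp add: sum_distrib_left)
  also have "(\<Sum>j=1..n. ?a j) = (real n + 1) / 2"
  proof -
    have "(\<Sum>j=1..n. real n + 1 - real j) = real n * (real n + 1) / 2"
      using double_gauss_sum_from_Suc_0[where ?'a = real, of n]
      by (simp add: sum_subtractf algebra_simps)
    then show ?thesis using n by (simp add: sum_divide_distrib[symmetric])
  qed
  also have "exp (- c * (t / K) powr \<alpha> * ((real n + 1) / 2)) \<le> exp (- (c / 2 * (1 / K) powr \<alpha> * real n) * t powr \<alpha>)"
    using c t K by (simp add: powr_divide field_simps)
  finally show ?thesis .
qed

text \<open>The midpoint of 1 and \<open>1/\<alpha>\<close>: above 1 for summability, below \<open>1/\<alpha>\<close> for integrability. This is
  where \<open>\<alpha> < 1\<close> is decisive.\<close>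
definition p :: real where "p = (1 + 1 / \<alpha>) / 2"

lemma p: "p > 1" "\<alpha> * p < 1"
  using \<alpha> by (auto simp: p_def field_simps)

lemma prob_walk_avg_le:
  assumes K: "1 / K \<le> d" "K > 0"
  shows "\<exists>C. \<forall>n\<ge>1. prob {\<omega> \<in> space M. \<bar>walk_avg Xs n \<omega>\<bar> \<le> K} \<le> C * real n powr - p"
proof (intro exI allI impI)
  fix n :: nat assume n: "n \<ge> 1"
  let ?D = "distr M borel (walk_avg Xs n)" and ?c = "c / 2 * (1 / K) powr \<alpha>"
  interpret D: real_distribution ?D by (rule real_distribution_walk_avg)
  have "prob {\<omega> \<in> space M. \<bar>walk_avg Xs n \<omega>\<bar> \<le> K} = measure ?D {-K..K}"
    by (subst measure_distr) (auto intro!: arg_cong[where f = prob] simp: abs_le_iff)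
  also have "\<dots> \<le> 4 * integral {0..1} (\<lambda>t. cmod (char ?D (t / K)))"
    by (rule D.concentration_le_integral_char) (rule K)
  also have "\<dots> \<le> 4 * ((p / (?c * real n)) powr p / (1 - \<alpha> * p))"
  proof (intro mult_left_mono integral_exp_powr_le)
    show "(\<lambda>t. cmod (char ?D (t / K))) integrable_on {0..1}"
      using K by (intro integrable_continuous_interval continuous_at_imp_continuous_on ballI continuous_intros
          continuous_within_compose3[OF D.isCont_char]) auto
    show "cmod (char ?D (t / K)) \<le> exp (- (?c * real n) * t powr \<alpha>)" if "0 < t" "t \<le> 1" for t
      using cmod_char_walk_avg_le[OF K n that] .
  qed (use \<alpha> p c K n in auto)
  also have "\<dots> = 4 * (p / ?c) powr p / (1 - \<alpha> * p) * real n powr - p"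
    using p c K n by (simp add: powr_divide powr_mult powr_minus field_simps)
  finally show "prob {\<omega> \<in> space M. \<bar>walk_avg Xs n \<omega>\<bar> \<le> K}
    \<le> 4 * (p / ?c) powr p / (1 - \<alpha> * p) * real n powr - p" .
qed

lemma summable_prob_walk_avg_le:
  "summable (\<lambda>n. prob {\<omega> \<in> space M. \<bar>walk_avg Xs n \<omega>\<bar> \<le> K})"
proof -
  \<comment> \<open>enlarging \<open>K\<close> only enlarges the event, and brings \<open>1 / K\<close> into the range of the bound near 0\<close>
  define K' where "K' = max K (1 / d)"
  have K': "1 / K' \<le> d" "K' > 0" "K \<le> K'"
  proof -
    show "K \<le> K'" unfolding K'_def by simp
    have "1 / d > 0" "1 / d \<le> K'" using d by (auto simp: K'_def)
    then show "K' > 0" by linarith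
    with \<open>1 / d \<le> K'\<close> d show "1 / K' \<le> d" by (simp add: field_simps)
  qed
  obtain C where C: "\<And>n. n \<ge> 1 \<Longrightarrow>
      prob {\<omega> \<in> space M. \<bar>walk_avg Xs n \<omega>\<bar> \<le> K'} \<le> C * real n powr - p"
    using prob_walk_avg_le[OF K'(1,2)] by blast
  show ?thesis
  proof (rule summable_comparison_test')
    show "summable (\<lambda>n. C * real n powr - p)"
      using p by (intro summable_mult) (simp add: summable_real_powr_iff)
    fix n :: nat assume "n \<ge> 1"
    have "prob {\<omega> \<in> space M. \<bar>walk_avg Xs n \<omega>\<bar> \<le> K} \<le> prob {\<omega> \<in> space M. \<bar>walk_avg Xs n \<omega>\<bar> \<le> K'}"
      using K'(3) by (intro finite_measure_mono) auto
    then show "norm (prob {\<omega> \<in> space M. \<bar>walk_avg Xs n \<omega>\<bar> \<le> K}) \<le> C * real n powr - p"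
      using C[OF \<open>n \<ge> 1\<close>] by simp
  qed
qed

lemma AE_abs_walk_avg_at_top:
  "AE \<omega> in M. filterlim (\<lambda>n. \<bar>walk_avg Xs n \<omega>\<bar>) at_top sequentially"
proof -
  have "AE \<omega> in M. \<forall>\<^sub>F n in sequentially. \<omega> \<in> space M - {\<omega> \<in> space M. \<bar>walk_avg Xs n \<omega>\<bar> \<le> real K}" for K
    by (intro borel_cantelli_AE1 summable_prob_walk_avg_le) (auto simp: less_top[symmetric])
  then have "AE \<omega> in M. \<forall>K::nat. \<forall>\<^sub>F n in sequentially.
      \<omega> \<in> space M - {\<omega> \<in> space M. \<bar>walk_avg Xs n \<omega>\<bar> \<le> real K}"
    by (simp add: AE_all_countable)
  then show ?thesis
  proof (rule AE_mp, intro AE_I2 impI)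
    fix \<omega> assume *: "\<forall>K::nat. \<forall>\<^sub>F n in sequentially.
      \<omega> \<in> space M - {\<omega> \<in> space M. \<bar>walk_avg Xs n \<omega>\<bar> \<le> real K}"
    show "filterlim (\<lambda>n. \<bar>walk_avg Xs n \<omega>\<bar>) at_top sequentially"
      unfolding filterlim_at_top
    proof
      fix Z :: real
      obtain K :: nat where K: "Z \<le> real K" using real_arch_simple by blast
      show "\<forall>\<^sub>F n in sequentially. Z \<le> \<bar>walk_avg Xs n \<omega>\<bar>"
        using *[rule_format, of K] by eventually_elim (use K in auto)
    qed
  qed
qed

text \<open>Both signs are equally likely by symmetry, and summability at \<open>K = 0\<close> makes the probability of
  the value 0 vanish in the limit.\<close>
lemma prob_walk_avg_pos_tendsto:
  "(\<lambda>n. prob {\<omega> \<in> space M. 0 < walk_avg Xs n \<omega>}) \<longlonglongrightarrow> 1 / 2"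
proof -
  let ?z = "\<lambda>n. prob {\<omega> \<in> space M. walk_avg Xs n \<omega> = 0}"
  have "(\<lambda>n. prob {\<omega> \<in> space M. \<bar>walk_avg Xs n \<omega>\<bar> \<le> 0}) \<longlonglongrightarrow> 0"
    by (rule summable_LIMSEQ_zero[OF summable_prob_walk_avg_le])
  then have "(\<lambda>n. (1 - ?z n) / 2) \<longlonglongrightarrow> (1 - 0) / 2"
    by (intro tendsto_intros) auto
  moreover have "prob {\<omega> \<in> space M. 0 < walk_avg Xs n \<omega>} = (1 - ?z n) / 2" for n
  proof -
    interpret neg: symmetric_walk M "\<lambda>i \<omega>. - Xs i \<omega>" \<mu> \<alpha> c d
      by (rule symmetric_walk_uminus)
    let ?G = "walk_avg Xs n" and ?G' = "walk_avg (\<lambda>i \<omega>. - Xs i \<omega>) n"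
    have "prob {\<omega> \<in> space M. 0 < ?G \<omega>} = measure (distr M borel ?G) {0<..}"
      by (subst measure_distr) (auto intro!: arg_cong[where f = prob])
    also have "\<dots> = measure (distr M borel ?G') {0<..}"
      by (simp add: distr_walk_avg_uminus)
    also have "\<dots> = prob {\<omega> \<in> space M. ?G \<omega> < 0}"
      by (subst measure_distr) (auto intro!: arg_cong[where f = prob] simp: walk_avg_uminus)
    finally have eq: "prob {\<omega> \<in> space M. 0 < ?G \<omega>} = prob {\<omega> \<in> space M. ?G \<omega> < 0}" .
    have "1 = prob ({\<omega> \<in> space M. 0 < ?G \<omega>} \<union> ({\<omega> \<in> space M. ?G \<omega> < 0} \<union> {\<omega> \<in> space M. ?G \<omega> = 0}))"
      by (subst prob_space[symmetric]) (auto intro!: arg_cong[where f = prob])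
    also have "\<dots> = prob {\<omega> \<in> space M. 0 < ?G \<omega>} + (prob {\<omega> \<in> space M. ?G \<omega> < 0} + ?z n)"
      by (subst finite_measure_Union; (subst finite_measure_Union)?) auto
    finally show ?thesis using eq by simp
  qed
  ultimately show ?thesis by (simp only: diff_zero)
qed

text \<open>By the zero-one law it suffices to refute that the averages are almost surely bounded above.
  Since their modulus tends to infinity, they would then be eventually nonpositive, contradicting
  the limit \<open>1/2\<close> of the probability of being positive.\<close>
lemma AE_unbounded_above_walk_avg:
  "AE \<omega> in M. unbounded_above (\<lambda>n. walk_avg Xs n \<omega>)"
  using unbounded_above_walk_avg_0_1[OF indep]
proof
  assume never: "AE \<omega> in M. \<not> unbounded_above (\<lambda>n. walk_avg Xs n \<omega>)"
  have "AE \<omega> in M. (\<lambda>n. indicator {\<omega> \<in> space M. 0 < walk_avg Xs n \<omega>} \<omega> :: real) \<longlonglongrightarrow> 0"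
    using never AE_abs_walk_avg_at_top
  proof eventually_elim
    case (elim \<omega>)
    then obtain K N :: nat where KN: "\<And>n. n \<ge> N \<Longrightarrow> walk_avg Xs n \<omega> \<le> real K"
      unfolding unbounded_above_def by (meson not_less)
    have "\<forall>\<^sub>F n in sequentially. real K + 1 \<le> \<bar>walk_avg Xs n \<omega>\<bar>"
      using elim(2) by (auto simp: filterlim_at_top)
    then have "\<forall>\<^sub>F n in sequentially. indicator {\<omega> \<in> space M. 0 < walk_avg Xs n \<omega>} \<omega> = (0::real)"
      using eventually_ge_at_top[of N]
    proof eventually_elim
      case (elim n)
      then show ?case using KN[of n] by (auto simp: indicator_def)
    qed
    then show ?case by (rule tendsto_eventually)
  qed
  then have "(\<lambda>n. \<integral>\<omega>. indicator {\<omega> \<in> space M. 0 < walk_avg Xs n \<omega>} \<omega> \<partial>M) \<longlonglongrightarrow> (\<integral>\<omega>. (0::real) \<partial>M)"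
    by (intro integral_dominated_convergence[where w = "\<lambda>_. 1"]) auto
  then have "(\<lambda>n. prob {\<omega> \<in> space M. 0 < walk_avg Xs n \<omega>}) \<longlonglongrightarrow> 0"
    by (simp add: Int_absorb2)
  from LIMSEQ_unique[OF this prob_walk_avg_pos_tendsto] show ?thesis by simp
qed

lemma AE_limsup_walk_avg: "AE \<omega> in M. limsup (\<lambda>n. ereal (walk_avg Xs n \<omega>)) = \<infinity>"
  using AE_unbounded_above_walk_avg by eventually_elim (rule limsup_eq_infty_of_unbounded_above)

lemma AE_liminf_walk_avg: "AE \<omega> in M. liminf (\<lambda>n. ereal (walk_avg Xs n \<omega>)) = - \<infinity>"
proof -
  interpret neg: symmetric_walk M "\<lambda>i \<omega>. - Xs i \<omega>" \<mu> \<alpha> c d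
    by (rule symmetric_walk_uminus)
  have "limsup (\<lambda>n. ereal (- walk_avg Xs n \<omega>)) = - liminf (\<lambda>n. ereal (walk_avg Xs n \<omega>))" for \<omega>
    using ereal_Limsup_uminus[of sequentially "\<lambda>n. ereal (walk_avg Xs n \<omega>)"] by simp
  then show ?thesis
    using neg.AE_limsup_walk_avg by (simp add: walk_avg_uminus ereal_uminus_eq_reorder)
qed

end

section \<open>Oscillation and divergence of the averages\<close>

theorem theorem1p6:
  fixes M :: "'a measure"
    and X :: "'a \<Rightarrow> real"
    and Xs :: "nat \<Rightarrow> 'a \<Rightarrow> real"
    and b h \<alpha> :: real
  assumes "prob_space M"
    and "X \<in> borel_measurable M"
    and indep: "prob_space.indep_vars M (\<lambda>_. borel) Xs {1..}"
    and ident: "\<And>i. i \<ge> 1 \<Longrightarrow> distr M borel (Xs i) = distr M borel X"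
    and "h > 0"
    and lattice: "measure M {\<omega> \<in> space M. X \<omega> \<in> affine_lattice b h} = 1"
    and maximal: "\<And>b' h'. h' > 0 \<Longrightarrow>
      measure M {\<omega> \<in> space M. X \<omega> \<in> affine_lattice b' h'} = 1 \<Longrightarrow> h' \<le> h"
    and symmetric: "distr M borel X = distr M borel (\<lambda>\<omega>. - X \<omega>)"
    and "0 < \<alpha>" and "\<alpha> < 1"
    and attraction: "in_normal_attraction M Xs \<alpha>"
  shows "AE \<omega> in M.
      liminf (\<lambda>n. ereal (walk_avg Xs n \<omega>)) = - \<infinity> \<and>
      limsup (\<lambda>n. ereal (walk_avg Xs n \<omega>)) = \<infinity> \<and>
      filterlim (\<lambda>n. \<bar>walk_avg Xs n \<omega>\<bar>) at_top sequentially"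
proof -
  interpret prob_space M by fact
  obtain c d where "c > 0" "d > 0"
    and "\<And>s. 0 < s \<Longrightarrow> s \<le> d \<Longrightarrow> cmod (char (distr M borel X) s) \<le> exp (- c * s powr \<alpha>)"
    using char_bound_of_normal_attraction[OF indep ident \<open>0 < \<alpha>\<close> attraction] by auto
  moreover have "distr (distr M borel X) borel uminus = distr M borel X"
    using symmetric \<open>X \<in> borel_measurable M\<close> by (subst distr_distr) (auto simp: comp_def)
  ultimately interpret symmetric_walk M Xs "distr M borel X" \<alpha> c d
    using indep ident \<open>0 < \<alpha>\<close> \<open>\<alpha> < 1\<close> by unfold_locales auto
  show ?thesis
    using AE_liminf_walk_avg AE_limsup_walk_avg AE_abs_walk_avg_at_top by eventually_elim simp
qed

end
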